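(* Let $X$ and $Y$ be two rooted trees such that each vertex has at least two children (and finitely many neighbors). Let $\varepsilon_X,\varepsilon_Y>0$ and let $\partial X$ and $\partial Y$ be equipped with the visual metrics $d_X$ and $d_Y$ determined by $\varepsilon_X$ and $\varepsilon_Y$. Suppose that $f:\partial X\to\partial Y$ is an $\eta$-quasisymmetric map, where $$\eta(t)=\begin{cases}A t^{\alpha_1},& t\le1,\\ A t^{\alpha_2},& t\ge1,\end{cases}\qquad \alpha_1,\alpha_2,A>0.$$ Then there is an $(L,\Lambda)$-rough quasiisometry $F:X\to Y$ which extends continuously along geodesics in $X$ to $f$, and such that for all $x_1,x_2\in X$, $$L_1|x_1-x_2|-\Lambda\le|F(x_1)-F(x_2)|\le L_2|x_1-x_2|+\Lambda,$$ where $$L_1=\frac{\alpha_1\varepsilon_X}{\varepsilon_Y},\quad L_2=\frac{\alpha_2\varepsilon_X}{\varepsilon_Y},\quad L=\max\Bigl\{\frac1{L_1},L_2\Bigr\}\quad\text{and}\quad\Lambda=\frac{2\log A}{\varepsilon_Y}.$$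
   Context: A rooted tree $X$ is a connected graph without cycles, with a distinguished vertex $0_X$ (the root), all vertices having finite degree. The neighbor of a vertex closer to the root is its parent, all other neighbors are its children. For vertices, $|x-y|$ denotes the number of edges in the geodesic from $x$ to $y$. Rough quasiisometries are regarded as maps between the vertex sets, and $x\in X$ denotes a vertex. The weighted metric on $X$ is $d_X(x,y)=\int_{[x,y]}e^{-\varepsilon_X|z|}\,d|z|$, where $|z|$ is the distance from the root and $d|z|$ gives each edge Lebesgue measure $1$. The boundary $\partial X$ is the completion of $X$ minus $X$; its points are identified with the infinite geodesics starting at $0_X$. For distinct $\zeta,\xi\in\partial X$ whose geodesics from $0_X$ share exactly their first $k$ edges, the visual metric is $d_X(\zeta,\xi)=\frac{2}{\varepsilon_X}e^{-\varepsilon_Xk}$. Similarly for $Y$ with $\varepsilon_Y$. A homeomorphism $f:Z\to W$ between metric spaces is $\eta$-quasisymmetric, where $\eta:[0,\infty)\to[0,\infty)$ is a homeomorphism, if $\frac{d_W(f(x),f(y))}{d_W(f(x),f(z))}\le\eta\bigl(\frac{d_Z(x,y)}{d_Z(x,z)}\bigr)$ for all $x,y,z\in Z$ with $x\ne z$. A (not necessarily continuous) map $F:X\to Y$ is an $(L,\Lambda)$-rough quasiisometry if $\frac1L|x-y|-\Lambda\le|F(x)-F(y)|\le L|x-y|+\Lambda$ for all $x,y\in X$, and for each $y\in Y$ there is $x\in X$ with $|F(x)-y|\le L+\Lambda$. $F$ extends continuously along geodesics to $f$ means: for every $\zeta\in\partial X$, if $0_X=x_0,x_1,x_2,\dots$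 are the consecutive vertices of the geodesic from $0_X$ to $\zeta$, then $F(x_i)\to f(\zeta)$ in the completion of $(Y,d_Y)$ as $i\to\infty$. *)

theory Defs
  imports "HOL-Analysis.Analysis"
begin

section \<open>Rooted trees\<close>

text \<open>Edges are unordered, so the adjacency relation is required to be symmetric and irreflexive
  in \<open>rooted_tree\<close> below; multiple edges cannot occur in this encoding.\<close>

record 'a rooted_graph =
  verts :: "'a set"
  adj :: "'a \<Rightarrow> 'a \<Rightarrow> bool"
  root :: 'a

definition walk :: "'a rooted_graph \<Rightarrow> 'a \<Rightarrow> 'a list \<Rightarrow> 'a \<Rightarrow> bool" where
  "walk X x p y \<longleftrightarrow>
     p \<noteq> [] \<and> set p \<subseteq> verts X \<and> successively (adj X) p \<and> hd p = x \<and> last p = y"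

definition simple_cycle :: "'a rooted_graph \<Rightarrow> 'a list \<Rightarrow> bool" where
  "simple_cycle X c \<longleftrightarrow>
     3 \<le> length c \<and> distinct c \<and> set c \<subseteq> verts X \<and> successively (adj X) c \<and>
     adj X (last c) (hd c)"

definition rooted_tree :: "'a rooted_graph \<Rightarrow> bool" where
  "rooted_tree X \<longleftrightarrow>
     root X \<in> verts X \<and>
     (\<forall>x\<in>verts X. \<forall>y\<in>verts X. adj X x y \<longrightarrow> adj X y x) \<and>
     (\<forall>x\<in>verts X. \<not> adj X x x) \<and>
     (\<forall>x\<in>verts X. \<forall>y\<in>verts X. \<exists>p. walk X x p y) \<and>
     (\<nexists>c. simple_cycle X c) \<and>
     (\<forall>x\<in>verts X. finite {y \<in> verts X. adj X x y})"

text \<open>A walk with \<open>n\<close> edges is a list of \<open>Suc n\<close> vertices.\<close>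

definition gdist :: "'a rooted_graph \<Rightarrow> 'a \<Rightarrow> 'a \<Rightarrow> nat" where
  "gdist X x y = (LEAST n. \<exists>p. walk X x p y \<and> length p = Suc n)"

definition depth :: "'a rooted_graph \<Rightarrow> 'a \<Rightarrow> nat" where
  "depth X x = gdist X (root X) x"

text \<open>The parent of \<open>x\<close> is its neighbour closer to the root; all other neighbours are children.\<close>

definition children :: "'a rooted_graph \<Rightarrow> 'a \<Rightarrow> 'a set" where
  "children X x = {y \<in> verts X. adj X x y \<and> \<not> depth X y < depth X x}"

definition geodesic :: "'a rooted_graph \<Rightarrow> 'a \<Rightarrow> 'a list \<Rightarrow> 'a \<Rightarrow> bool" where
  "geodesic X x p y \<longleftrightarrow> walk X x p y \<and> length p = Suc (gdist X x y)"


section \<open>The weighted metric, the boundary and the completion\<close>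

text \<open>Along the edge joining \<open>a\<close> and \<open>b\<close> the distance to the root runs through the unit interval
  between \<open>depth X a\<close> and \<open>depth X b\<close>.\<close>

definition edge_weight :: "'a rooted_graph \<Rightarrow> real \<Rightarrow> 'a \<Rightarrow> 'a \<Rightarrow> real" where
  "edge_weight X \<epsilon> a b =
     integral {real (min (depth X a) (depth X b)) .. real (max (depth X a) (depth X b))}
       (\<lambda>t. exp (- \<epsilon> * t))"

definition weighted_dist :: "'a rooted_graph \<Rightarrow> real \<Rightarrow> 'a \<Rightarrow> 'a \<Rightarrow> real" where
  "weighted_dist X \<epsilon> x y =
     (let p = (THE p. geodesic X x p y)
      in \<Sum>i<length p - 1. edge_weight X \<epsilon> (p ! i) (p ! Suc i))"

text \<open>Boundary points are represented by the infinite geodesics starting at the root, given by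
  their sequences of consecutive vertices.\<close>

definition boundary :: "'a rooted_graph \<Rightarrow> (nat \<Rightarrow> 'a) set" where
  "boundary X =
     {\<zeta>. \<zeta> 0 = root X \<and> range \<zeta> \<subseteq> verts X \<and> (\<forall>i. adj X (\<zeta> i) (\<zeta> (Suc i))) \<and>
         (\<forall>i j. i \<le> j \<longrightarrow> gdist X (\<zeta> i) (\<zeta> j) = j - i)}"

definition common_edges :: "(nat \<Rightarrow> 'a) \<Rightarrow> (nat \<Rightarrow> 'a) \<Rightarrow> nat" where
  "common_edges \<zeta> \<xi> = (THE k. (\<forall>i\<le>k. \<zeta> i = \<xi> i) \<and> \<zeta> (Suc k) \<noteq> \<xi> (Suc k))"

definition visual_dist :: "real \<Rightarrow> (nat \<Rightarrow> 'a) \<Rightarrow> (nat \<Rightarrow> 'a) \<Rightarrow> real" where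
  "visual_dist \<epsilon> \<zeta> \<xi> =
     (if \<zeta> = \<xi> then 0 else 2 / \<epsilon> * exp (- \<epsilon> * real (common_edges \<zeta> \<xi>)))"

text \<open>The completion of the vertex set consists of the vertices (\<open>Inl\<close>) and the boundary points
  (\<open>Inr\<close>). Each of its points is the class of a Cauchy sequence of vertices: the constant sequence
  for a vertex, the sequence of vertices of the geodesic for a boundary point. As usual, the metric
  of the completion is the limit of the distances between representing sequences.\<close>

fun cauchy_rep :: "'a + (nat \<Rightarrow> 'a) \<Rightarrow> nat \<Rightarrow> 'a" where
  "cauchy_rep (Inl x) = (\<lambda>n. x)"
| "cauchy_rep (Inr \<zeta>) = \<zeta>"

definition completion_dist ::
    "'a rooted_graph \<Rightarrow> real \<Rightarrow> 'a + (nat \<Rightarrow> 'a) \<Rightarrow> 'a + (nat \<Rightarrow> 'a) \<Rightarrow> real" where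
  "completion_dist X \<epsilon> p q = lim (\<lambda>n. weighted_dist X \<epsilon> (cauchy_rep p n) (cauchy_rep q n))"


section \<open>Quasisymmetric maps and rough quasiisometries\<close>

definition quasisymmetric ::
    "'a set \<Rightarrow> ('a \<Rightarrow> 'a \<Rightarrow> real) \<Rightarrow> 'b set \<Rightarrow> ('b \<Rightarrow> 'b \<Rightarrow> real) \<Rightarrow> (real \<Rightarrow> real) \<Rightarrow> ('a \<Rightarrow> 'b) \<Rightarrow> bool"
  where
  "quasisymmetric Z dZ W dW \<eta> f \<longleftrightarrow>
     homeomorphic_map (Metric_space.mtopology Z dZ) (Metric_space.mtopology W dW) f \<and>
     homeomorphic_map (top_of_set {0..}) (top_of_set {0..}) \<eta> \<and>
     (\<forall>x\<in>Z. \<forall>y\<in>Z. \<forall>z\<in>Z. x \<noteq> z \<longrightarrow> dW (f x) (f y) / dW (f x) (f z) \<le> \<eta> (dZ x y / dZ x z))"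

definition rough_quasiisometry ::
    "'a rooted_graph \<Rightarrow> 'b rooted_graph \<Rightarrow> real \<Rightarrow> real \<Rightarrow> ('a \<Rightarrow> 'b) \<Rightarrow> bool" where
  "rough_quasiisometry X Y L \<Lambda> F \<longleftrightarrow>
     F ` verts X \<subseteq> verts Y \<and>
     (\<forall>x\<in>verts X. \<forall>y\<in>verts X.
        1 / L * real (gdist X x y) - \<Lambda> \<le> real (gdist Y (F x) (F y)) \<and>
        real (gdist Y (F x) (F y)) \<le> L * real (gdist X x y) + \<Lambda>) \<and>
     (\<forall>y\<in>verts Y. \<exists>x\<in>verts X. real (gdist Y (F x) y) \<le> L + \<Lambda>)"

definition extends_along_geodesics ::
    "'a rooted_graph \<Rightarrow> 'b rooted_graph \<Rightarrow> real \<Rightarrow> ('a \<Rightarrow> 'b) \<Rightarrow> ((nat \<Rightarrow> 'a) \<Rightarrow> (nat \<Rightarrow> 'b)) \<Rightarrow> bool"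
  where
  "extends_along_geodesics X Y \<epsilon>Y F f \<longleftrightarrow>
     (\<forall>\<zeta>\<in>boundary X.
        (\<lambda>i. completion_dist Y \<epsilon>Y (Inl (F (\<zeta> i))) (Inr (f \<zeta>))) \<longlonglongrightarrow> 0)"


section \<open>The visual metric is a metric\<close>

text \<open>This justifies the use of \<open>Metric_space.mtopology\<close> for boundaries.\<close>

lemma common_edges_eqI:
  assumes "\<forall>i\<le>k. \<zeta> i = \<xi> i" "\<zeta> (Suc k) \<noteq> \<xi> (Suc k)"
  shows "common_edges \<zeta> \<xi> = k"
  unfolding common_edges_def
proof (rule the_equality)
  fix m assume m: "(\<forall>i\<le>m. \<zeta> i = \<xi> i) \<and> \<zeta> (Suc m) \<noteq> \<xi> (Suc m)"
  show "m = k"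
    using assms m by (metis Suc_leI linorder_neqE_nat)
qed (use assms in auto)

lemma common_edges_props:
  assumes "\<zeta> 0 = \<xi> 0" "\<zeta> \<noteq> \<xi>"
  shows "\<forall>i\<le>common_edges \<zeta> \<xi>. \<zeta> i = \<xi> i"
    and "\<zeta> (Suc (common_edges \<zeta> \<xi>)) \<noteq> \<xi> (Suc (common_edges \<zeta> \<xi>))"
proof -
  define m where "m = (LEAST n. \<zeta> n \<noteq> \<xi> n)"
  obtain n where "\<zeta> n \<noteq> \<xi> n"
    using assms(2) by blast
  then have m: "\<zeta> m \<noteq> \<xi> m"
    unfolding m_def by (rule LeastI)
  have below: "\<zeta> i = \<xi> i" if "i < m" for i
    using that not_less_Least unfolding m_def by blast
  from m assms(1) obtain k where k: "m = Suc k"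
    by (cases m) auto
  have "common_edges \<zeta> \<xi> = k"
    by (rule common_edges_eqI) (use m below k in auto)
  then show "\<forall>i\<le>common_edges \<zeta> \<xi>. \<zeta> i = \<xi> i"
    and "\<zeta> (Suc (common_edges \<zeta> \<xi>)) \<noteq> \<xi> (Suc (common_edges \<zeta> \<xi>))"
    using m below k by auto
qed

lemma Metric_space_boundary:
  assumes "\<epsilon> > 0"
  shows "Metric_space (boundary X) (visual_dist \<epsilon>)"
proof
  fix \<zeta> \<xi> :: "nat \<Rightarrow> 'a"
  show nonneg: "0 \<le> visual_dist \<epsilon> \<zeta> \<xi>" for \<zeta> \<xi> :: "nat \<Rightarrow> 'a"
    using assms by (simp add: visual_dist_def)
  show "visual_dist \<epsilon> \<zeta> \<xi> = visual_dist \<epsilon> \<xi> \<zeta>"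
    unfolding visual_dist_def common_edges_def by (simp add: eq_commute)
  show "visual_dist \<epsilon> \<zeta> \<xi> = 0 \<longleftrightarrow> \<zeta> = \<xi>"
    using assms by (simp add: visual_dist_def)
  fix \<omega> assume "\<zeta> \<in> boundary X" "\<xi> \<in> boundary X" "\<omega> \<in> boundary X"
  then have roots: "\<zeta> 0 = \<xi> 0" "\<xi> 0 = \<omega> 0" "\<zeta> 0 = \<omega> 0"
    by (auto simp: boundary_def)
  show "visual_dist \<epsilon> \<zeta> \<omega> \<le> visual_dist \<epsilon> \<zeta> \<xi> + visual_dist \<epsilon> \<xi> \<omega>"
  proof (cases "\<zeta> = \<xi> \<or> \<xi> = \<omega> \<or> \<zeta> = \<omega>")
    case True
    then show ?thesis
      using nonneg[of \<zeta> \<xi>] nonneg[of \<xi> \<omega>] by (auto simp: visual_dist_def)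
  next
    case False
    let ?k = "common_edges \<zeta> \<omega>"
    have "common_edges \<zeta> \<xi> \<le> ?k \<or> common_edges \<xi> \<omega> \<le> ?k"
      using common_edges_props[of \<zeta> \<omega>] common_edges_props[of \<zeta> \<xi>] common_edges_props[of \<xi> \<omega>]
        roots False by (metis not_less_eq_eq)
    then have "visual_dist \<epsilon> \<zeta> \<omega> \<le> visual_dist \<epsilon> \<zeta> \<xi> \<or> visual_dist \<epsilon> \<zeta> \<omega> \<le> visual_dist \<epsilon> \<xi> \<omega>"
      using False assms by (auto simp: visual_dist_def divide_simps)
    then show ?thesis
      using nonneg[of \<zeta> \<xi>] nonneg[of \<xi> \<omega>] by linarith
  qed
qed

end

theory Submission
  imports Defs
begin

text \<open>The vertex \<open>x\<close> of \<open>X\<close> stands for its shadow, the set of boundary points whose rays pass through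
  \<open>x\<close>. Since every vertex has two children, the shadow has visual diameter exactly
  \<open>2 / \<epsilon>X * exp (- \<epsilon>X * depth X x)\<close>. The map \<open>F\<close> sends \<open>x\<close> to the confluent of the image of its
  shadow under \<open>f\<close>, that is, to the last vertex through which all these rays of \<open>Y\<close> pass; the
  image then has diameter \<open>2 / \<epsilon>Y * exp (- \<epsilon>Y * depth Y (F x))\<close>. All statements about \<open>F\<close>
  thereby become statements about diameters, and quasisymmetry compares these.

  Visual distances are exponentials of branching depths, so after taking logarithms quasisymmetry
  is an affine inequality between branching depths (\<open>branching_lower\<close>, \<open>branching_upper\<close>):
  the exponents \<open>\<alpha>\<^sub>1\<close> and \<open>\<alpha>\<^sub>2\<close> become the slopes \<open>L\<^sub>1\<close> and \<open>L\<^sub>2\<close>, and the factor \<open>A\<close> becomes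
  the additive error \<open>C = ln A / \<epsilon>Y\<close>. Since \<open>\<Lambda> = 2 * C\<close>, this error may be spent only twice.

  Let \<open>k\<close> be the depth of the meet of \<open>x\<close> and \<open>y\<close>, so that \<open>|x - y|\<close> is the sum of \<open>depth x - k\<close>
  and \<open>depth y - k\<close>. For the upper estimate one goes from \<open>F x\<close> to \<open>F y\<close> through the image of the
  meet; each leg is vertical and costs one \<open>C\<close> (\<open>F_depth_upper\<close>). For the lower estimate the image
  of the meet is the wrong vertex to compare with, because the meet of \<open>F x\<close> and \<open>F y\<close> may lie
  below it, and that loss would add to the error of each leg. Instead, choose rays \<open>\<zeta>\<close> through \<open>x\<close> and \<open>\<xi>\<close> through \<open>y\<close> that part at depth \<open>k\<close>. Their
  images pass through \<open>F x\<close> and \<open>F y\<close>, hence run together at least down to the meet of these two,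
  and quasisymmetry for the triple of \<open>\<zeta>\<close>, \<open>\<xi>\<close> and a further ray through \<open>x\<close> bounds the
  height of \<open>F x\<close> over that meet from below (\<open>F_depth_lower\<close>); the same applies to \<open>y\<close>.

  Finally, for a ray \<open>\<zeta>\<close> the vertices \<open>F (\<zeta> n)\<close> all lie on the ray \<open>f \<zeta>\<close>. They start at the root,
  because \<open>f\<close> is onto, tend to infinity, and move on by at most \<open>L\<^sub>2 + C\<close> in each step,
  so they come that close to every vertex of \<open>f \<zeta>\<close>. Since every vertex of \<open>Y\<close> lies on such a ray,
  \<open>F\<close> is coarsely onto. Tending to infinity along \<open>f \<zeta>\<close> is convergence to the boundary point \<open>f \<zeta>\<close>.\<close>

section \<open>Walks and graph distance\<close>

lemma walk_singleton: "x \<in> verts X \<Longrightarrow> walk X x [x] x"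
  by (simp add: walk_def)

lemma walk_ends: "walk X x p y \<Longrightarrow> x \<in> verts X \<and> y \<in> verts X"
  unfolding walk_def by (metis hd_in_set last_in_set subsetD)

lemma walk_Cons:
  assumes "walk X y p z" "x \<in> verts X" "adj X x y"
  shows "walk X x (x # p) z"
  using assms by (cases p) (auto simp: walk_def)

lemma walk_snoc:
  assumes "walk X x p y" "z \<in> verts X" "adj X y z"
  shows "walk X x (p @ [z]) z"
  using assms by (auto simp: walk_def successively_append_iff)

lemma walk_append:
  assumes "walk X x p y" "walk X y q z"
  shows "walk X x (p @ tl q) z"
proof (cases q)
  case Nil
  then show ?thesis using assms by (simp add: walk_def)
next
  case (Cons a q')
  then show ?thesis using assms
    by (cases q') (auto simp: walk_def successively_append_iff)
qed

lemma gdist_le_walk: "walk X x p y \<Longrightarrow> gdist X x y \<le> length p - 1"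
  unfolding gdist_def by (rule Least_le) (auto simp: walk_def intro!: exI[of _ p])

locale tree =
  fixes X :: "'a rooted_graph"
  assumes rooted_tree: "rooted_tree X"
begin

lemma root_in_verts: "root X \<in> verts X"
  and adj_sym: "x \<in> verts X \<Longrightarrow> y \<in> verts X \<Longrightarrow> adj X x y \<Longrightarrow> adj X y x"
  and adj_irrefl: "x \<in> verts X \<Longrightarrow> \<not> adj X x x"
  and walk_exists: "x \<in> verts X \<Longrightarrow> y \<in> verts X \<Longrightarrow> \<exists>p. walk X x p y"
  and no_simple_cycle: "\<not> simple_cycle X c"
  using rooted_tree unfolding rooted_tree_def by blast+

lemma shortest_walk:
  assumes "x \<in> verts X" "y \<in> verts X"
  obtains p where "walk X x p y" "length p = Suc (gdist X x y)"
proof -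
  obtain q where q: "walk X x q y" using walk_exists assms by blast
  then have "length q = Suc (length q - 1)" by (simp add: walk_def)
  with q have "\<exists>n p. walk X x p y \<and> length p = Suc n" by blast
  then have "\<exists>p. walk X x p y \<and> length p = Suc (gdist X x y)"
    unfolding gdist_def by (rule LeastI_ex)
  then show thesis using that by blast
qed

lemma gdist_triangle:
  assumes "x \<in> verts X" "y \<in> verts X" "z \<in> verts X"
  shows "gdist X x z \<le> gdist X x y + gdist X y z"
proof -
  obtain p where p: "walk X x p y" "length p = Suc (gdist X x y)"
    using shortest_walk assms by blast
  obtain q where q: "walk X y q z" "length q = Suc (gdist X y z)"
    using shortest_walk assms by blast
  show ?thesis
    using gdist_le_walk[OF walk_append[OF p(1) q(1)]] p(2) q(2) by simp
qed

lemma walk_rev: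
  assumes "walk X x p y"
  shows "walk X y (rev p) x"
proof -
  have "successively (\<lambda>a b. adj X b a) p"
    using assms adj_sym unfolding walk_def
    by (metis (no_types, lifting) successively_mono subset_code(1))
  then show ?thesis
    using assms by (auto simp: walk_def hd_rev last_rev)
qed

lemma gdist_commute:
  assumes "x \<in> verts X" "y \<in> verts X"
  shows "gdist X x y = gdist X y x"
proof -
  have "gdist X y x \<le> gdist X x y" if V: "x \<in> verts X" "y \<in> verts X" for x y
  proof -
    obtain p where p: "walk X x p y" "length p = Suc (gdist X x y)"
      using shortest_walk V by blast
    show ?thesis using gdist_le_walk[OF walk_rev[OF p(1)]] p(2) by simp
  qed
  with assms show ?thesis by (simp add: antisym)
qed


section \<open>Depth and parents\<close>

lemma depth_root: "depth X (root X) = 0"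
  using gdist_le_walk[OF walk_singleton[OF root_in_verts]] by (simp add: depth_def)

lemma depth_eq_0: 
  assumes "x \<in> verts X" "depth X x = 0"
  shows "x = root X"
proof -
  obtain p where p: "walk X (root X) p x" "length p = Suc (gdist X (root X) x)"
    using shortest_walk[OF root_in_verts assms(1)] by blast
  then have "length p = 1" using assms(2) by (simp add: depth_def)
  then show ?thesis using p(1) by (cases p) (auto simp: walk_def)
qed

lemma depth_Lipschitz:
  assumes "x \<in> verts X" "y \<in> verts X"
  shows "depth X y \<le> depth X x + gdist X x y"
  unfolding depth_def by (rule gdist_triangle[OF root_in_verts assms])

lemma depth_adj_le:
  assumes "x \<in> verts X" "y \<in> verts X" "adj X x y"
  shows "depth X y \<le> Suc (depth X x)"
  using depth_Lipschitz[OF assms(1,2)] gdist_le_walk[OF walk_Cons[OF walk_singleton[OF assms(2)] assms(1,3)]]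
  by simp

lemma parent_exists:
  assumes "x \<in> verts X" "depth X x = Suc n"
  obtains w where "w \<in> verts X" "adj X w x" "depth X w = n"
proof -
  obtain p where p: "walk X (root X) p x" "length p = Suc (Suc n)"
    using shortest_walk[OF root_in_verts assms(1)] assms(2) by (auto simp: depth_def)
  define q where "q = butlast p"
  have pq: "p = q @ [x]"
    using p append_butlast_last_id[of p] by (simp add: walk_def q_def)
  have q: "q \<noteq> []" "length q = Suc n"
    using p(2) by (auto simp: pq)
  have w: "walk X (root X) q (last q)" "adj X (last q) x"
    using p(1) q unfolding pq by (auto simp: walk_def successively_append_iff)
  have V: "last q \<in> verts X" using walk_ends[OF w(1)] by simp
  have "depth X (last q) \<le> n"
    using gdist_le_walk[OF w(1)] q by (simp add: depth_def)
  moreover have "Suc n \<le> Suc (depth X (last q))"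
    using depth_adj_le[OF V assms(1) w(2)] assms(2) by simp
  ultimately show thesis using that V w(2) by auto
qed

text \<open>Climbing simultaneously from two vertices at the same height until the two ways up meet
  gives a path that never goes deeper than its ends. Such a path could be closed to a cycle by an
  edge between its ends or by a common child of them.\<close>

lemma simple_path_above:
  assumes "x \<in> verts X" "y \<in> verts X" "x \<noteq> y" "depth X x = n" "depth X y = n"
  shows "\<exists>p. walk X x p y \<and> distinct p \<and> (\<forall>v\<in>set p. depth X v \<le> n) \<and> 3 \<le> length p"
  using assms
proof (induction n arbitrary: x y)
  case 0
  then show ?case using depth_eq_0 by blast
next
  case (Suc n)
  obtain a where a: "a \<in> verts X" "adj X a x" "depth X a = n"
    using parent_exists[OF Suc.prems(1,4)] .
  obtain b where b: "b \<in> verts X" "adj X b y" "depth X b = n"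
    using parent_exists[OF Suc.prems(2,5)] .
  obtain p where p: "walk X a p b" "distinct p" "\<forall>v\<in>set p. depth X v \<le> n"
  proof (cases "a = b")
    case True
    then show ?thesis using that[of "[a]"] a walk_singleton[of a X] by auto
  next
    case False
    then show ?thesis using that Suc.IH[OF a(1) b(1)] a b by blast
  qed
  have "walk X x (x # p @ [y]) y"
    using walk_Cons[OF walk_snoc[OF p(1) Suc.prems(2) b(2)] Suc.prems(1)] adj_sym a Suc.prems(1)
    by blast
  moreover have "distinct (x # p @ [y])"
    using p Suc.prems by fastforce
  moreover have "\<forall>v\<in>set (x # p @ [y]). depth X v \<le> Suc n"
    using p Suc.prems by auto
  moreover have "3 \<le> length (x # p @ [y])"
    using p(1) by (cases p) (auto simp: walk_def)
  ultimately show ?case by blast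
qed

lemma adj_depth_neq:
  assumes "x \<in> verts X" "y \<in> verts X" "adj X x y"
  shows "depth X x \<noteq> depth X y"
proof
  assume "depth X x = depth X y"
  then obtain p where "walk X x p y" "distinct p" "3 \<le> length p"
    using simple_path_above[of x y] assms adj_irrefl by metis
  then have "simple_cycle X p"
    using adj_sym assms by (auto simp: simple_cycle_def walk_def)
  then show False using no_simple_cycle by blast
qed

lemma adj_depth_cases:
  assumes "x \<in> verts X" "y \<in> verts X" "adj X x y"
  shows "depth X y = Suc (depth X x) \<or> depth X x = Suc (depth X y)"
  using adj_depth_neq[OF assms] depth_adj_le[OF assms] depth_adj_le[OF assms(2,1) adj_sym[OF assms]]
  by linarith

lemma parent_unique:
  assumes "x \<in> verts X" "y \<in> verts X" "z \<in> verts X" "adj X x z" "adj X y z"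
    and "depth X z = Suc (depth X x)" "depth X z = Suc (depth X y)"
  shows "x = y"
proof (rule ccontr)
  assume "x \<noteq> y"
  then obtain p where p: "walk X x p y" "distinct p" "3 \<le> length p" "\<forall>v\<in>set p. depth X v \<le> depth X x"
    using simple_path_above[of x y "depth X x"] assms by auto
  then have "walk X z (z # p) y" using walk_Cons adj_sym assms by metis
  moreover have "z \<notin> set p" using p(4) assms(6) by auto
  ultimately have "simple_cycle X (z # p)"
    using p assms(5) by (auto simp: simple_cycle_def walk_def)
  then show False using no_simple_cycle by blast
qed


section \<open>Rays from the root\<close>

lemma ray_in_verts: "\<zeta> \<in> boundary X \<Longrightarrow> \<zeta> i \<in> verts X"
  and ray_root: "\<zeta> \<in> boundary X \<Longrightarrow> \<zeta> 0 = root X"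
  and ray_adj: "\<zeta> \<in> boundary X \<Longrightarrow> adj X (\<zeta> i) (\<zeta> (Suc i))"
  and ray_gdist: "\<zeta> \<in> boundary X \<Longrightarrow> i \<le> j \<Longrightarrow> gdist X (\<zeta> i) (\<zeta> j) = j - i"
  by (auto simp: boundary_def)

lemma ray_depth: "\<zeta> \<in> boundary X \<Longrightarrow> depth X (\<zeta> i) = i"
  using ray_gdist[of \<zeta> 0 i] by (simp add: depth_def ray_root)

lemma walk_along:
  assumes "\<And>i. \<zeta> i \<in> verts X" "\<And>i. adj X (\<zeta> i) (\<zeta> (Suc i))" "m \<le> n"
  shows "walk X (\<zeta> m) (map \<zeta> [m..<Suc n]) (\<zeta> n)"
  using assms(3)
proof (induction n rule: dec_induct)
  case base
  show ?case using walk_singleton[OF assms(1)[of m]] by simp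
next
  case (step n)
  then show ?case using walk_snoc[OF step.IH assms(1) assms(2)] by simp
qed

lemma boundaryI:
  assumes "\<And>i. \<zeta> i \<in> verts X" "\<And>i. adj X (\<zeta> i) (\<zeta> (Suc i))" "\<And>i. depth X (\<zeta> i) = i"
  shows "\<zeta> \<in> boundary X"
proof -
  have "gdist X (\<zeta> i) (\<zeta> j) = j - i" if "i \<le> j" for i j
    using gdist_le_walk[OF walk_along[of \<zeta>, OF assms(1,2) that]] that
      depth_Lipschitz[OF assms(1)[of i] assms(1)[of j]] assms(3) by simp
  then show ?thesis
    using assms depth_eq_0[of "\<zeta> 0"] by (auto simp: boundary_def)
qed

text \<open>Parents are unique, so two rays that share a vertex coincide all the way up from it.\<close>

lemma rays_agree_above:
  assumes "\<zeta> \<in> boundary X" "\<xi> \<in> boundary X" "\<zeta> n = \<xi> n" "i \<le> n"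
  shows "\<zeta> i = \<xi> i"
  using assms(4)
proof (induction rule: inc_induct)
  case base
  show ?case by (rule assms)
next
  case (step k)
  have "adj X (\<xi> k) (\<zeta> (Suc k))" using ray_adj[OF assms(2)] step by simp
  then show ?case
    using parent_unique[of "\<zeta> k" "\<xi> k" "\<zeta> (Suc k)"] ray_in_verts ray_adj ray_depth assms by simp
qed

lemma common_edges_ge:
  assumes "\<zeta> \<in> boundary X" "\<xi> \<in> boundary X" "\<zeta> \<noteq> \<xi>" "\<zeta> n = \<xi> n"
  shows "n \<le> common_edges \<zeta> \<xi>"
proof (rule ccontr)
  assume "\<not> n \<le> common_edges \<zeta> \<xi>"
  then have "\<zeta> (Suc (common_edges \<zeta> \<xi>)) = \<xi> (Suc (common_edges \<zeta> \<xi>))"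
    by (intro rays_agree_above[OF assms(1,2,4)]) simp
  then show False using common_edges_props(2)[of \<zeta> \<xi>] assms by (simp add: ray_root)
qed

lemma rays_agree_common_edges:
  assumes "\<zeta> \<in> boundary X" "\<xi> \<in> boundary X" "\<zeta> \<noteq> \<xi>" "i \<le> common_edges \<zeta> \<xi>"
  shows "\<zeta> i = \<xi> i"
  using common_edges_props(1)[of \<zeta> \<xi>] assms by (simp add: ray_root)

lemma common_edges_eq:
  assumes "\<zeta> \<in> boundary X" "\<xi> \<in> boundary X" "\<zeta> n = \<xi> n" "\<zeta> (Suc n) \<noteq> \<xi> (Suc n)"
  shows "common_edges \<zeta> \<xi> = n"
  using assms rays_agree_above by (intro common_edges_eqI) auto


section \<open>Distance from a vertex to the end of a ray\<close>

text \<open>A geodesic between two vertices of a ray has no edge to spare: it must go down in every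
  step. Its vertices are therefore determined, from the lower end, as successive parents.\<close>

lemma geodesic_along_ray:
  assumes "\<zeta> \<in> boundary X" "m \<le> n"
  shows "geodesic X (\<zeta> m) p (\<zeta> n) \<longleftrightarrow> p = map \<zeta> [m..<Suc n]"
proof
  assume "p = map \<zeta> [m..<Suc n]"
  then show "geodesic X (\<zeta> m) p (\<zeta> n)"
    using walk_along[of \<zeta> m n] ray_in_verts ray_adj ray_gdist assms by (simp add: geodesic_def Suc_diff_le)
next
  assume "geodesic X (\<zeta> m) p (\<zeta> n)"
  then have p: "set p \<subseteq> verts X" "successively (adj X) p" "p ! 0 = \<zeta> m" "p ! (n - m) = \<zeta> n"
    and len: "length p = Suc (n - m)"
    using ray_gdist[OF assms] by (auto simp: geodesic_def walk_def hd_conv_nth last_conv_nth)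
  have V: "p ! i \<in> verts X" if "i \<le> n - m" for i
    using p(1) len that by (metis less_Suc_eq_le nth_mem subsetD)
  have adj: "adj X (p ! i) (p ! Suc i)" if "i < n - m" for i
    using p(2) len that by (simp add: successively_conv_nth)
  have upper: "depth X (p ! i) \<le> m + i" if "i \<le> n - m" for i
    using that
  proof (induction i)
    case 0
    then show ?case using p(3) ray_depth[OF assms(1)] by simp
  next
    case (Suc i)
    then show ?case using depth_adj_le[OF V V adj, of i] by simp
  qed
  have "p ! i = \<zeta> (m + i)" if "i \<le> n - m" for i
    using that
  proof (induction rule: inc_induct)
    case base
    then show ?case using p(4) assms(2) by simp
  next
    case (step i)
    have a: "adj X (p ! i) (\<zeta> (Suc (m + i)))" using adj[of i] step by simp
    have Vi: "p ! i \<in> verts X" using V step by simp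
    have "depth X (\<zeta> (Suc (m + i))) = Suc (depth X (p ! i))"
      using adj_depth_cases[OF Vi ray_in_verts[OF assms(1)] a] upper[of i] step ray_depth assms(1) by auto
    then show ?case
      using parent_unique[OF Vi ray_in_verts[OF assms(1)] ray_in_verts[OF assms(1)] a ray_adj[OF assms(1)]]
        ray_depth assms(1) by simp
  qed
  then show "p = map \<zeta> [m..<Suc n]"
    using len assms(2) by (intro nth_equalityI) (auto simp: simp del: upt_Suc)
qed

lemma edge_weight_ray:
  assumes "\<zeta> \<in> boundary X" "\<epsilon> > 0"
  shows "edge_weight X \<epsilon> (\<zeta> i) (\<zeta> (Suc i)) = exp (- \<epsilon> * real i) / \<epsilon> - exp (- \<epsilon> * real (Suc i)) / \<epsilon>"
proof -
  have "((\<lambda>t. exp (- \<epsilon> * t)) has_integral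
      (- exp (- \<epsilon> * real (Suc i)) / \<epsilon> - (- exp (- \<epsilon> * real i) / \<epsilon>))) {real i .. real (Suc i)}"
    using assms(2)
    by (intro fundamental_theorem_of_calculus)
      (auto intro!: derivative_eq_intros simp: has_real_derivative_iff_has_vector_derivative[symmetric])
  then show ?thesis
    using assms by (simp add: edge_weight_def ray_depth integral_unique)
qed

lemma weighted_dist_ray:
  assumes "\<zeta> \<in> boundary X" "\<epsilon> > 0" "m \<le> n"
  shows "weighted_dist X \<epsilon> (\<zeta> m) (\<zeta> n) = exp (- \<epsilon> * real m) / \<epsilon> - exp (- \<epsilon> * real n) / \<epsilon>"
proof -
  define h where "h i = exp (- \<epsilon> * real (m + i)) / \<epsilon>" for i
  have "(THE p. geodesic X (\<zeta> m) p (\<zeta> n)) = map \<zeta> [m..<Suc n]"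
    using geodesic_along_ray[OF assms(1,3)] by simp
  then have "weighted_dist X \<epsilon> (\<zeta> m) (\<zeta> n) = 
      (\<Sum>i<n - m. edge_weight X \<epsilon> (\<zeta> (m + i)) (\<zeta> (Suc (m + i))))"
    using assms(3) unfolding weighted_dist_def Let_def
    by (auto simp: Suc_diff_le simp del: upt_Suc intro!: sum.cong)
  also have "\<dots> = (\<Sum>i<n - m. h i - h (Suc i))"
    using edge_weight_ray[OF assms(1,2)] by (simp add: h_def)
  also have "\<dots> = h 0 - h (n - m)" by (rule sum_lessThan_telescope')
  finally show ?thesis using assms(3) by (simp add: h_def)
qed

lemma completion_dist_ray:
  assumes "\<zeta> \<in> boundary X" "\<epsilon> > 0"
  shows "completion_dist X \<epsilon> (Inl (\<zeta> m)) (Inr \<zeta>) = exp (- \<epsilon> * real m) / \<epsilon>"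
proof -
  have "(\<lambda>n. exp (- \<epsilon> * real m) / \<epsilon> - exp (- \<epsilon> * real n) / \<epsilon>) \<longlonglongrightarrow> exp (- \<epsilon> * real m) / \<epsilon> - 0 / \<epsilon>"
    using assms(2) by (intro tendsto_intros exp_at_bot[THEN filterlim_compose]
        filterlim_tendsto_neg_mult_at_bot[OF tendsto_const _ filterlim_real_sequentially]) auto
  moreover have "\<forall>\<^sub>F n in sequentially. exp (- \<epsilon> * real m) / \<epsilon> - exp (- \<epsilon> * real n) / \<epsilon>
      = weighted_dist X \<epsilon> (\<zeta> m) (\<zeta> n)"
    using eventually_ge_at_top[of m] by eventually_elim (simp add: weighted_dist_ray[OF assms])
  ultimately have "(\<lambda>n. weighted_dist X \<epsilon> (\<zeta> m) (\<zeta> n)) \<longlonglongrightarrow> exp (- \<epsilon> * real m) / \<epsilon>"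
    by (auto elim: Lim_transform_eventually)
  then show ?thesis by (simp add: completion_dist_def limI)
qed

end


section \<open>Shadows and meets\<close>

definition shadow :: "'a rooted_graph \<Rightarrow> 'a \<Rightarrow> (nat \<Rightarrow> 'a) set" where
  "shadow X x = {\<zeta> \<in> boundary X. \<zeta> (depth X x) = x}"

locale branching_tree = tree +
  assumes two_children: "x \<in> verts X \<Longrightarrow> 2 \<le> card (children X x)"
begin

lemma child_depth: "x \<in> verts X \<Longrightarrow> c \<in> children X x \<Longrightarrow> depth X c = Suc (depth X x)"
  using adj_depth_cases[of x c] by (auto simp: children_def)

lemma child_avoiding:
  assumes "x \<in> verts X"
  obtains c where "c \<in> verts X" "adj X x c" "depth X c = Suc (depth X x)" "c \<noteq> v"
proof -
  have "\<not> children X x \<subseteq> {v}"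
  proof
    assume "children X x \<subseteq> {v}"
    then have "card (children X x) \<le> 1" using card_mono[of "{v}" "children X x"] by simp
    then show False using two_children[OF assms] by simp
  qed
  then obtain c where "c \<in> children X x" "c \<noteq> v" by blast
  then show thesis using that[of c] child_depth[OF assms, of c] by (auto simp: children_def)
qed

lemma child_choice:
  obtains s where "\<And>x. x \<in> verts X \<Longrightarrow> s x \<in> verts X \<and> adj X x (s x) \<and> depth X (s x) = Suc (depth X x)"
proof -
  have "\<forall>x\<in>verts X. \<exists>c. c \<in> verts X \<and> adj X x c \<and> depth X c = Suc (depth X x)"
    using child_avoiding by metis
  then show thesis using that by metis
qed

lemma ray_extends:
  assumes "\<xi> \<in> boundary X" "c \<in> verts X" "adj X (\<xi> n) c" "depth X c = Suc n"
  obtains \<zeta> where "\<zeta> \<in> boundary X" "\<zeta> n = \<xi> n" "\<zeta> (Suc n) = c"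
proof -
  obtain s where s: "\<And>x. x \<in> verts X \<Longrightarrow> s x \<in> verts X \<and> adj X x (s x) \<and> depth X (s x) = Suc (depth X x)"
    using child_choice by blast
  define \<zeta> where "\<zeta> i = (if i \<le> n then \<xi> i else (s ^^ (i - Suc n)) c)" for i
  have it: "(s ^^ k) c \<in> verts X \<and> depth X ((s ^^ k) c) = Suc n + k" for k
    by (induction k) (use assms s in auto)
  have V: "\<zeta> i \<in> verts X" for i
    using it ray_in_verts[OF assms(1)] by (simp add: \<zeta>_def)
  have d: "depth X (\<zeta> i) = i" for i
    using it[of "i - Suc n"] ray_depth[OF assms(1)] by (simp add: \<zeta>_def)
  have a: "adj X (\<zeta> i) (\<zeta> (Suc i))" for i
  proof -
    consider "i < n" | "i = n" | "i > n" by linarith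
    then show ?thesis
    proof cases
      case 3
      then have "Suc i - Suc n = Suc (i - Suc n)" by simp
      then show ?thesis using 3 s it by (simp add: \<zeta>_def)
    qed (use ray_adj[OF assms(1)] assms(3) in \<open>auto simp: \<zeta>_def\<close>)
  qed
  show thesis
    by (rule that[OF boundaryI[of \<zeta>, OF V a d]]) (auto simp: \<zeta>_def)
qed

lemma boundary_nonempty: "\<exists>\<zeta>. \<zeta> \<in> boundary X"
proof -
  obtain s where s: "\<And>x. x \<in> verts X \<Longrightarrow> s x \<in> verts X \<and> adj X x (s x) \<and> depth X (s x) = Suc (depth X x)"
    using child_choice by blast
  have it: "(s ^^ k) (root X) \<in> verts X \<and> depth X ((s ^^ k) (root X)) = k" for k
    by (induction k) (use root_in_verts depth_root s in auto)
  show ?thesis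
    using boundaryI[of "\<lambda>k. (s ^^ k) (root X)"] it s by auto
qed

lemma shadow_nonempty:
  assumes "x \<in> verts X"
  obtains \<zeta> where "\<zeta> \<in> shadow X x"
proof -
  have "\<exists>\<zeta>\<in>boundary X. \<zeta> n = x" if "x \<in> verts X" "depth X x = n" for n
    using that
  proof (induction n arbitrary: x)
    case 0
    then show ?case using boundary_nonempty ray_root depth_eq_0 by metis
  next
    case (Suc n)
    obtain w where w: "w \<in> verts X" "adj X w x" "depth X w = n"
      using parent_exists Suc.prems by blast
    obtain \<xi> where "\<xi> \<in> boundary X" "\<xi> n = w" using Suc.IH w by blast
    then show ?case using ray_extends w Suc.prems by metis
  qed
  then show thesis using that assms by (auto simp: shadow_def)
qed

lemma ray_branches_off:
  assumes "\<xi> \<in> boundary X"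
  obtains \<zeta> where "\<zeta> \<in> boundary X" "\<zeta> n = \<xi> n" "\<zeta> \<noteq> \<xi>" "common_edges \<xi> \<zeta> = n" "common_edges \<zeta> \<xi> = n"
proof -
  obtain c where c: "c \<in> verts X" "adj X (\<xi> n) c" "depth X c = Suc n" "c \<noteq> \<xi> (Suc n)"
    using child_avoiding[OF ray_in_verts[OF assms, of n], of "\<xi> (Suc n)"] ray_depth[OF assms] by metis
  obtain \<zeta> where z: "\<zeta> \<in> boundary X" "\<zeta> n = \<xi> n" "\<zeta> (Suc n) = c"
    using ray_extends[OF assms c(1-3)] .
  show thesis
    using that[OF z(1,2)] z c(4) common_edges_eq[OF assms z(1)] common_edges_eq[OF z(1) assms] by auto
qed

text \<open>A meet of \<open>x\<close> and \<open>y\<close> is given by its depth \<open>k\<close>: the vertex itself is \<open>\<zeta> k\<close> for any ray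
  through \<open>x\<close>. Following the walk backwards from \<open>y\<close>, where \<open>y\<close> is the meet with itself, each
  edge lengthens the way over the meet by at most one.\<close>

lemma meet_of_walk:
  assumes "walk X x p y"
  shows "\<exists>k. k \<le> depth X x \<and> k \<le> depth X y \<and> depth X x - k + (depth X y - k) \<le> length p - 1 \<and>
    (\<forall>\<zeta>\<in>shadow X x. \<forall>\<xi>\<in>shadow X y. \<zeta> k = \<xi> k)"
  using assms
proof (induction p arbitrary: x)
  case Nil
  then show ?case by (simp add: walk_def)
next
  case (Cons a p)
  have ax: "a = x" using Cons.prems by (simp add: walk_def)
  show ?case
  proof (cases p)
    case Nil
    then have "x = y" using Cons.prems by (auto simp: walk_def)
    then show ?thesis by (intro exI[of _ "depth X x"]) (auto simp: shadow_def)
  next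
    case (Cons x' p')
    have V: "x \<in> verts X" "x' \<in> verts X" "adj X x x'" and w: "walk X x' p y"
      using Cons.prems Cons by (auto simp: walk_def)
    obtain k where k: "k \<le> depth X x'" "k \<le> depth X y"
        "depth X x' - k + (depth X y - k) \<le> length p - 1"
      and agree: "\<And>\<zeta> \<xi>. \<zeta> \<in> shadow X x' \<Longrightarrow> \<xi> \<in> shadow X y \<Longrightarrow> \<zeta> k = \<xi> k"
      using Cons.IH[OF w] by blast
    have len: "length p - 1 = length p'" "length (a # p) - 1 = Suc (length p')" using Cons by auto
    show ?thesis
    proof (cases "depth X x = Suc (depth X x')")
      case True
      have "shadow X x \<subseteq> shadow X x'"
      proof
        fix \<zeta> assume "\<zeta> \<in> shadow X x"
        then have z: "\<zeta> \<in> boundary X" "\<zeta> (Suc (depth X x')) = x" by (auto simp: shadow_def True)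
        then have "\<zeta> (depth X x') = x'"
          using parent_unique[of "\<zeta> (depth X x')" x' x] ray_in_verts[OF z(1)] ray_depth[OF z(1)] V
            ray_adj[OF z(1), of "depth X x'"] True adj_sym[OF V] by simp
        with z show "\<zeta> \<in> shadow X x'" by (simp add: shadow_def)
      qed
      then show ?thesis using k agree len True by (intro exI[of _ k]) auto
    next
      case False
      then have d: "depth X x' = Suc (depth X x)" using adj_depth_cases[OF V] by simp
      obtain \<zeta>' where z': "\<zeta>' \<in> shadow X x'" using shadow_nonempty V by blast
      then have b: "\<zeta>' \<in> boundary X" "\<zeta>' (Suc (depth X x)) = x'" by (auto simp: shadow_def d)
      have x: "\<zeta>' (depth X x) = x"
        using parent_unique[of "\<zeta>' (depth X x)" x x'] ray_in_verts[OF b(1)] ray_depth[OF b(1)] V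
            ray_adj[OF b(1), of "depth X x"] b(2) d by simp
      \<comment> \<open>If \<open>x'\<close> itself was the meet, then the meet moves up to its parent \<open>x\<close>.\<close>
      define l where "l = min k (depth X x)"
      have "\<zeta> l = \<xi> l" if s: "\<zeta> \<in> shadow X x" "\<xi> \<in> shadow X y" for \<zeta> \<xi>
      proof -
        have "\<zeta> l = \<zeta>' l"
          using s(1) x rays_agree_above[of \<zeta> \<zeta>' "depth X x" l] b(1) by (simp add: shadow_def l_def)
        also have "\<zeta>' l = \<xi> l"
          using s(2) rays_agree_above[of \<zeta>' \<xi> k l] agree[OF z' s(2)] b(1) by (simp add: shadow_def l_def)
        finally show ?thesis .
      qed
      moreover have "depth X x - l + (depth X y - l) \<le> Suc (length p')"
        using k d len by (auto simp: l_def min_def)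
      ultimately show ?thesis using k d len by (intro exI[of _ l]) (auto simp: l_def)
    qed
  qed
qed

lemma gdist_via_rays:
  assumes "\<zeta> \<in> boundary X" "\<xi> \<in> boundary X" "\<zeta> k = \<xi> k" "k \<le> m" "k \<le> n"
  shows "gdist X (\<zeta> m) (\<xi> n) \<le> (m - k) + (n - k)"
proof -
  have "gdist X (\<zeta> m) (\<xi> n) \<le> gdist X (\<zeta> m) (\<zeta> k) + gdist X (\<xi> k) (\<xi> n)"
    using gdist_triangle[of "\<zeta> m" "\<zeta> k" "\<xi> n"] ray_in_verts assms by simp
  also have "gdist X (\<zeta> m) (\<zeta> k) = m - k"
    using gdist_commute[of "\<zeta> m" "\<zeta> k"] ray_in_verts ray_gdist[OF assms(1,4)] assms(1) by simp
  also have "gdist X (\<xi> k) (\<xi> n) = n - k" by (rule ray_gdist[OF assms(2,5)])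
  finally show ?thesis .
qed

text \<open>Among the rays through \<open>x\<close> and \<open>y\<close> there is a pair that separates exactly at the meet. If
  neither vertex lies above the other, every pair does, since running together any further would
  give a shorter way. Otherwise the ray through the upper vertex is chosen to leave the other
  ray there.\<close>

lemma meet_exists:
  assumes "x \<in> verts X" "y \<in> verts X"
  obtains k \<zeta> \<xi> where "k \<le> depth X x" "k \<le> depth X y"
    "gdist X x y = (depth X x - k) + (depth X y - k)"
    "\<And>\<zeta> \<xi>. \<zeta> \<in> shadow X x \<Longrightarrow> \<xi> \<in> shadow X y \<Longrightarrow> \<zeta> k = \<xi> k"
    "\<zeta> \<in> shadow X x" "\<xi> \<in> shadow X y" "\<zeta> \<noteq> \<xi>" "common_edges \<zeta> \<xi> = k" "common_edges \<xi> \<zeta> = k"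
proof -
  obtain p where p: "walk X x p y" "length p = Suc (gdist X x y)" using shortest_walk assms .
  obtain k where k: "k \<le> depth X x" "k \<le> depth X y"
    "(depth X x - k) + (depth X y - k) \<le> gdist X x y"
    and agree: "\<And>\<zeta> \<xi>. \<zeta> \<in> shadow X x \<Longrightarrow> \<xi> \<in> shadow X y \<Longrightarrow> \<zeta> k = \<xi> k"
    using meet_of_walk[OF p(1)] p(2) by auto
  obtain \<zeta> where z: "\<zeta> \<in> shadow X x" using shadow_nonempty assms by blast
  obtain \<xi> where x: "\<xi> \<in> shadow X y" using shadow_nonempty assms by blast
  have zx: "\<zeta> \<in> boundary X" "\<xi> \<in> boundary X" "\<zeta> (depth X x) = x" "\<xi> (depth X y) = y" "\<zeta> k = \<xi> k"
    using z x agree by (auto simp: shadow_def)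
  have eq: "gdist X x y = (depth X x - k) + (depth X y - k)"
    using k gdist_via_rays[OF zx(1,2,5) k(1,2)] zx by simp
  have "\<exists>\<zeta>\<in>shadow X x. \<exists>\<xi>\<in>shadow X y. \<zeta> \<noteq> \<xi> \<and> common_edges \<zeta> \<xi> = k \<and> common_edges \<xi> \<zeta> = k"
  proof -
    consider "k = depth X x" | "k = depth X y" | "k < depth X x" "k < depth X y"
      using k by linarith
    then show ?thesis
    proof cases
      case 1
      obtain \<zeta>' where "\<zeta>' \<in> boundary X" "\<zeta>' k = \<xi> k" "\<zeta>' \<noteq> \<xi>" "common_edges \<xi> \<zeta>' = k" "common_edges \<zeta>' \<xi> = k"
        using ray_branches_off[OF zx(2)] .
      then show ?thesis using 1 zx x by (auto simp: shadow_def)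
    next
      case 2
      obtain \<xi>' where "\<xi>' \<in> boundary X" "\<xi>' k = \<zeta> k" "\<xi>' \<noteq> \<zeta>" "common_edges \<zeta> \<xi>' = k" "common_edges \<xi>' \<zeta> = k"
        using ray_branches_off[OF zx(1)] .
      then show ?thesis using 2 zx z by (intro bexI[of _ \<zeta>] bexI[of _ \<xi>']) (auto simp: shadow_def)
    next
      case 3
      have "\<zeta> (Suc k) \<noteq> \<xi> (Suc k)"
        using gdist_via_rays[OF zx(1,2), of "Suc k" "depth X x" "depth X y"] zx 3 eq by auto
      then show ?thesis
        using z x zx common_edges_eq[of \<zeta> \<xi> k] common_edges_eq[of \<xi> \<zeta> k] by metis
    qed
  qed
  then show thesis using that k(1,2) eq agree by blast
qed

end


section \<open>The confluent of a set of rays\<close>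

text \<open>The rays of \<open>S\<close> run together exactly down to this depth.\<close>

definition branch_depth :: "(nat \<Rightarrow> 'b) set \<Rightarrow> nat" where
  "branch_depth S = (LEAST n. \<exists>a\<in>S. \<exists>b\<in>S. a (Suc n) \<noteq> b (Suc n))"

lemma (in tree) agree_to_branch_depth:
  assumes "S \<subseteq> boundary X" "a \<in> S" "b \<in> S" "i \<le> branch_depth S"
  shows "a i = b i"
proof (cases i)
  case 0
  then show ?thesis using assms ray_root by (metis subsetD)
next
  case (Suc n)
  then have "n < branch_depth S" using assms(4) by simp
  then show ?thesis using not_less_Least assms(2,3) Suc unfolding branch_depth_def by blast
qed

lemma (in tree) branch_depth_le:
  assumes "S \<subseteq> boundary X" "a \<in> S" "b \<in> S" "a \<noteq> b"
  shows "branch_depth S \<le> common_edges a b"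
  using common_edges_ge agree_to_branch_depth[OF assms(1-3) order_refl] assms by blast

text \<open>Of two rays in \<open>S\<close> that separate at the branching depth, at least one separates there from
  the given ray \<open>a\<close>. This is the ultrametric fact that the diameter is attained from every point.\<close>

lemma (in tree) branch_depth_attained:
  assumes "S \<subseteq> boundary X" "a \<in> S" "b \<in> S" "a \<noteq> b"
  obtains c where "c \<in> S" "c \<noteq> a" "common_edges a c = branch_depth S"
proof -
  have "a (Suc (common_edges a b)) \<noteq> b (Suc (common_edges a b))"
    using common_edges_props(2)[of a b] assms ray_root by (metis subsetD)
  then have "\<exists>n. \<exists>a\<in>S. \<exists>b\<in>S. a (Suc n) \<noteq> b (Suc n)" using assms(2,3) by blast
  then have "\<exists>u\<in>S. \<exists>v\<in>S. u (Suc (branch_depth S)) \<noteq> v (Suc (branch_depth S))"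
    unfolding branch_depth_def by (rule LeastI_ex)
  then obtain c where c: "c \<in> S" "a (Suc (branch_depth S)) \<noteq> c (Suc (branch_depth S))" by metis
  moreover have "a (branch_depth S) = c (branch_depth S)"
    using agree_to_branch_depth assms c(1) by blast
  ultimately show thesis
    using that[of c] common_edges_eq[of a c] assms by auto
qed


section \<open>Quasisymmetry in terms of branching depths\<close>

locale power_quasisymmetry = X: branching_tree X + Y: branching_tree Y
  for X :: "'a rooted_graph" and Y :: "'b rooted_graph" +
  fixes \<epsilon>X \<epsilon>Y \<alpha>\<^sub>1 \<alpha>\<^sub>2 A :: real
    and \<eta> :: "real \<Rightarrow> real"
    and f :: "(nat \<Rightarrow> 'a) \<Rightarrow> (nat \<Rightarrow> 'b)"
  assumes positive: "\<epsilon>X > 0" "\<epsilon>Y > 0" "\<alpha>\<^sub>1 > 0" "\<alpha>\<^sub>2 > 0" "A > 0"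
    and \<eta>_power: "t \<ge> 0 \<Longrightarrow> \<eta> t = (if t \<le> 1 then A * t powr \<alpha>\<^sub>1 else A * t powr \<alpha>\<^sub>2)"
    and quasisymmetric: "quasisymmetric (boundary X) (visual_dist \<epsilon>X) (boundary Y) (visual_dist \<epsilon>Y) \<eta> f"
begin

definition L\<^sub>1 :: real where "L\<^sub>1 = \<alpha>\<^sub>1 * \<epsilon>X / \<epsilon>Y"

definition L\<^sub>2 :: real where "L\<^sub>2 = \<alpha>\<^sub>2 * \<epsilon>X / \<epsilon>Y"

definition C :: real where "C = ln A / \<epsilon>Y"

lemma L_pos: "L\<^sub>1 > 0" "L\<^sub>2 > 0"
  using positive by (simp_all add: L\<^sub>1_def L\<^sub>2_def)

lemma image_boundary: "f ` boundary X = boundary Y"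
  and inj_on_boundary: "inj_on f (boundary X)"
  using quasisymmetric homeomorphic_imp_surjective_map homeomorphic_imp_injective_map
    Metric_space.topspace_mtopology[OF Metric_space_boundary] positive(1,2)
  unfolding quasisymmetric_def by metis+

lemma f_ray: "\<zeta> \<in> boundary X \<Longrightarrow> f \<zeta> \<in> boundary Y"
  using image_boundary by blast

lemma f_neq: "\<zeta> \<in> boundary X \<Longrightarrow> \<xi> \<in> boundary X \<Longrightarrow> \<zeta> \<noteq> \<xi> \<Longrightarrow> f \<zeta> \<noteq> f \<xi>"
  using inj_on_boundary by (auto dest: inj_onD)

text \<open>A ratio of visual distances depends only on the difference of the branching depths.\<close>

lemma quasisymmetry_exp:
  assumes "\<zeta> \<in> boundary X" "\<xi> \<in> boundary X" "\<omega> \<in> boundary X" "\<zeta> \<noteq> \<xi>" "\<zeta> \<noteq> \<omega>"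
  shows "exp (\<epsilon>Y * (real (common_edges (f \<zeta>) (f \<omega>)) - real (common_edges (f \<zeta>) (f \<xi>))))
    \<le> \<eta> (exp (\<epsilon>X * (real (common_edges \<zeta> \<omega>) - real (common_edges \<zeta> \<xi>))))"
proof -
  have ratio: "2 / \<epsilon> * exp (- \<epsilon> * a) / (2 / \<epsilon> * exp (- \<epsilon> * b)) = exp (\<epsilon> * (b - a))"
    if "\<epsilon> > 0" for \<epsilon> a b :: real
    using that by (simp add: exp_diff[symmetric] algebra_simps)
  have "visual_dist \<epsilon>Y (f \<zeta>) (f \<xi>) / visual_dist \<epsilon>Y (f \<zeta>) (f \<omega>)
      \<le> \<eta> (visual_dist \<epsilon>X \<zeta> \<xi> / visual_dist \<epsilon>X \<zeta> \<omega>)"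
    using quasisymmetric assms unfolding quasisymmetric_def by blast
  moreover have "f \<zeta> \<noteq> f \<xi>" "f \<zeta> \<noteq> f \<omega>" using assms f_neq by auto
  ultimately show ?thesis
    using assms(4,5) unfolding visual_dist_def by (simp only: if_False ratio positive)
qed

lemma branching_lower:
  assumes "\<zeta> \<in> boundary X" "\<xi> \<in> boundary X" "\<omega> \<in> boundary X" "\<zeta> \<noteq> \<xi>" "\<zeta> \<noteq> \<omega>"
    and "common_edges \<zeta> \<omega> \<le> common_edges \<zeta> \<xi>"
  shows "L\<^sub>1 * (real (common_edges \<zeta> \<xi>) - real (common_edges \<zeta> \<omega>)) - C
    \<le> real (common_edges (f \<zeta>) (f \<xi>)) - real (common_edges (f \<zeta>) (f \<omega>))"
proof -
  let ?a = "real (common_edges \<zeta> \<xi>)" and ?b = "real (common_edges \<zeta> \<omega>)"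
    and ?a' = "real (common_edges (f \<zeta>) (f \<xi>))" and ?b' = "real (common_edges (f \<zeta>) (f \<omega>))"
  have "\<epsilon>X * (?b - ?a) \<le> 0" using assms(6) positive by (simp add: mult_le_0_iff)
  then have "\<eta> (exp (\<epsilon>X * (?b - ?a))) = exp (ln A + \<alpha>\<^sub>1 * (\<epsilon>X * (?b - ?a)))"
    using \<eta>_power positive by (simp add: exp_add powr_def)
  then have "\<epsilon>Y * (?b' - ?a') \<le> ln A + \<alpha>\<^sub>1 * (\<epsilon>X * (?b - ?a))"
    using quasisymmetry_exp[OF assms(1-5)] by simp
  then have "?b' - ?a' \<le> (ln A + \<alpha>\<^sub>1 * (\<epsilon>X * (?b - ?a))) / \<epsilon>Y"
    using positive by (simp add: field_simps)
  also have "\<dots> = C - L\<^sub>1 * (?a - ?b)" by (simp add: C_def L\<^sub>1_def algebra_simps add_divide_distrib diff_divide_distrib)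
  finally show ?thesis by simp
qed

lemma branching_upper:
  assumes "\<zeta> \<in> boundary X" "\<xi> \<in> boundary X" "\<omega> \<in> boundary X" "\<zeta> \<noteq> \<xi>" "\<zeta> \<noteq> \<omega>"
    and "common_edges \<zeta> \<xi> \<le> common_edges \<zeta> \<omega>"
  shows "real (common_edges (f \<zeta>) (f \<omega>)) - real (common_edges (f \<zeta>) (f \<xi>))
    \<le> L\<^sub>2 * (real (common_edges \<zeta> \<omega>) - real (common_edges \<zeta> \<xi>)) + C"
proof -
  let ?a = "real (common_edges \<zeta> \<xi>)" and ?b = "real (common_edges \<zeta> \<omega>)"
    and ?a' = "real (common_edges (f \<zeta>) (f \<xi>))" and ?b' = "real (common_edges (f \<zeta>) (f \<omega>))"
  have "0 \<le> \<epsilon>X * (?b - ?a)" using assms(6) positive by simp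
  then have "\<eta> (exp (\<epsilon>X * (?b - ?a))) = exp (ln A + \<alpha>\<^sub>2 * (\<epsilon>X * (?b - ?a)))"
    using \<eta>_power positive by (simp add: exp_add powr_def)
  then have "\<epsilon>Y * (?b' - ?a') \<le> ln A + \<alpha>\<^sub>2 * (\<epsilon>X * (?b - ?a))"
    using quasisymmetry_exp[OF assms(1-5)] by simp
  then have "?b' - ?a' \<le> (ln A + \<alpha>\<^sub>2 * (\<epsilon>X * (?b - ?a))) / \<epsilon>Y"
    using positive by (simp add: field_simps)
  also have "\<dots> = L\<^sub>2 * (?b - ?a) + C" by (simp add: C_def L\<^sub>2_def algebra_simps add_divide_distrib diff_divide_distrib)
  finally show ?thesis .
qed

text \<open>Comparing a distance with itself shows \<open>A \<ge> 1\<close>.\<close>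

lemma C_nonneg: "C \<ge> 0"
proof -
  obtain \<zeta> where z: "\<zeta> \<in> boundary X" using X.boundary_nonempty by blast
  obtain \<xi> where "\<xi> \<in> boundary X" "\<xi> \<noteq> \<zeta>" using X.ray_branches_off[OF z] by metis
  then show ?thesis using branching_upper[of \<zeta> \<xi> \<xi>] z by auto
qed


section \<open>The map between the trees\<close>

definition F_depth :: "'a \<Rightarrow> nat" where
  "F_depth x = branch_depth (f ` shadow X x)"

definition F :: "'a \<Rightarrow> 'b" where
  "F x = f (SOME \<zeta>. \<zeta> \<in> shadow X x) (F_depth x)"

lemma shadow_image: "f ` shadow X x \<subseteq> boundary Y"
  using f_ray by (auto simp: shadow_def)

lemma F_on_ray:
  assumes "\<zeta> \<in> shadow X x"
  shows "f \<zeta> (F_depth x) = F x"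
  using Y.agree_to_branch_depth[OF shadow_image, of "f \<zeta>" x "f (SOME \<zeta>. \<zeta> \<in> shadow X x)"]
    someI[of "\<lambda>\<zeta>. \<zeta> \<in> shadow X x", OF assms] assms
  by (auto simp: F_def F_depth_def)

lemma F_in_verts: "x \<in> verts X \<Longrightarrow> F x \<in> verts Y"
  using X.shadow_nonempty F_on_ray Y.ray_in_verts f_ray by (metis (no_types, lifting) mem_Collect_eq shadow_def)

lemma depth_F: "x \<in> verts X \<Longrightarrow> depth Y (F x) = F_depth x"
  using X.shadow_nonempty F_on_ray Y.ray_depth f_ray by (metis (no_types, lifting) mem_Collect_eq shadow_def)

lemma f_shadow:
  assumes "x \<in> verts X" "\<zeta> \<in> shadow X x"
  shows "f \<zeta> \<in> shadow Y (F x)"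
  using F_on_ray[OF assms(2)] depth_F[OF assms(1)] f_ray assms by (simp add: shadow_def)

lemma shadow_ray: "\<zeta> \<in> boundary X \<Longrightarrow> \<zeta> \<in> shadow X (\<zeta> n)"
  by (simp add: shadow_def X.ray_depth)

lemma F_on_ray_vertex: "\<zeta> \<in> boundary X \<Longrightarrow> F (\<zeta> n) = f \<zeta> (F_depth (\<zeta> n))"
  using F_on_ray[OF shadow_ray] by simp

lemma F_depth_le:
  assumes "\<zeta> \<in> shadow X x" "\<xi> \<in> shadow X x" "\<zeta> \<noteq> \<xi>"
  shows "F_depth x \<le> common_edges (f \<zeta>) (f \<xi>)"
  unfolding F_depth_def
  using f_neq[of \<zeta> \<xi>] assms by (intro Y.branch_depth_le[OF shadow_image]) (auto simp: shadow_def)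

lemma F_depth_attained:
  assumes "\<zeta> \<in> shadow X x"
  obtains \<xi> where "\<xi> \<in> shadow X x" "\<xi> \<noteq> \<zeta>" "common_edges (f \<zeta>) (f \<xi>) = F_depth x"
proof -
  have z: "\<zeta> \<in> boundary X" "\<zeta> (depth X x) = x" using assms by (auto simp: shadow_def)
  obtain \<omega> where w: "\<omega> \<in> boundary X" "\<omega> (depth X x) = \<zeta> (depth X x)" "\<omega> \<noteq> \<zeta>"
    using X.ray_branches_off[OF z(1)] by metis
  then have "\<omega> \<in> shadow X x" using z by (simp add: shadow_def)
  then obtain c where "c \<in> f ` shadow X x" "c \<noteq> f \<zeta>" "common_edges (f \<zeta>) c = F_depth x"
    using Y.branch_depth_attained[OF shadow_image, of "f \<zeta>" x "f \<omega>"] f_neq[of \<zeta> \<omega>] w z assms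
    unfolding F_depth_def by blast
  then show thesis using that by blast
qed

text \<open>Let \<open>\<omega>\<close> be a ray through \<open>x\<close> whose image leaves that of \<open>\<zeta>\<close> exactly at \<open>F x\<close>. It stays with
  \<open>\<zeta>\<close> at least down to \<open>x\<close>, while \<open>\<xi>\<close> parts from \<open>\<zeta>\<close> no later than at \<open>x\<close>. So the image of \<open>\<omega>\<close>
  must stay with that of \<open>\<zeta>\<close> correspondingly longer than the image of \<open>\<xi>\<close> does, up to \<open>C\<close>.\<close>

lemma F_depth_lower:
  assumes "\<zeta> \<in> shadow X x" "\<xi> \<in> boundary X" "\<zeta> \<noteq> \<xi>" "common_edges \<zeta> \<xi> \<le> depth X x"
    and "f \<zeta> j = f \<xi> j"
  shows "L\<^sub>1 * (real (depth X x) - real (common_edges \<zeta> \<xi>)) - C \<le> real (F_depth x) - real j"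
proof -
  obtain \<omega> where w: "\<omega> \<in> shadow X x" "\<omega> \<noteq> \<zeta>" "common_edges (f \<zeta>) (f \<omega>) = F_depth x"
    using F_depth_attained[OF assms(1)] .
  have b: "\<zeta> \<in> boundary X" "\<omega> \<in> boundary X" using assms(1) w(1) by (auto simp: shadow_def)
  have x: "depth X x \<le> common_edges \<zeta> \<omega>"
    using X.common_edges_ge[OF b] assms(1) w(1,2) by (auto simp: shadow_def)
  have j: "j \<le> common_edges (f \<zeta>) (f \<xi>)"
    using Y.common_edges_ge[OF f_ray f_ray f_neq] assms b by blast
  have "L\<^sub>1 * (real (common_edges \<zeta> \<omega>) - real (common_edges \<zeta> \<xi>)) - C
      \<le> real (F_depth x) - real (common_edges (f \<zeta>) (f \<xi>))"
    using branching_lower[of \<zeta> \<omega> \<xi>] b assms w x by simp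
  moreover have "L\<^sub>1 * (real (depth X x) - real (common_edges \<zeta> \<xi>))
      \<le> L\<^sub>1 * (real (common_edges \<zeta> \<omega>) - real (common_edges \<zeta> \<xi>))"
    using x L_pos by (intro mult_left_mono) auto
  ultimately show ?thesis using j by linarith
qed

lemma F_depth_mono:
  assumes "\<zeta> \<in> boundary X" "\<xi> \<in> boundary X" "\<zeta> m = \<xi> m" "m \<le> n"
  shows "F_depth (\<zeta> m) \<le> F_depth (\<xi> n)"
proof -
  obtain \<omega> where w: "\<omega> \<in> shadow X (\<xi> n)" "\<omega> \<noteq> \<xi>" "common_edges (f \<xi>) (f \<omega>) = F_depth (\<xi> n)"
    using F_depth_attained[OF shadow_ray[OF assms(2)]] .
  have "\<omega> m = \<xi> m" 
    using w(1) X.rays_agree_above[of \<omega> \<xi> n m] assms(2,4) by (simp add: shadow_def X.ray_depth)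
  then have "\<omega> \<in> shadow X (\<xi> m)" using w(1) assms(2) by (simp add: shadow_def X.ray_depth)
  then show ?thesis
    using F_depth_le[OF shadow_ray[OF assms(2)], of \<omega> m] w assms(3) by auto
qed

text \<open>Here \<open>\<xi>\<close> realises the diameter of the image of the larger shadow and \<open>\<omega>\<close> the diameter of
  the smaller shadow itself. If \<open>\<xi>\<close> happens to lie in the smaller shadow too, then \<open>F\<close> sends both
  vertices to the same place.\<close>

lemma F_depth_upper:
  assumes "\<zeta> \<in> boundary X" "m \<le> n"
  shows "real (F_depth (\<zeta> n)) - real (F_depth (\<zeta> m)) \<le> L\<^sub>2 * (real n - real m) + C"
proof -
  obtain \<xi> where x: "\<xi> \<in> shadow X (\<zeta> m)" "\<xi> \<noteq> \<zeta>" "common_edges (f \<zeta>) (f \<xi>) = F_depth (\<zeta> m)"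
    using F_depth_attained[OF shadow_ray[OF assms(1)]] .
  obtain \<omega> where w: "\<omega> \<in> boundary X" "\<omega> n = \<zeta> n" "\<omega> \<noteq> \<zeta>" "common_edges \<zeta> \<omega> = n"
    using X.ray_branches_off[OF assms(1)] .
  have x': "\<xi> \<in> boundary X" "\<xi> m = \<zeta> m" using x(1) assms by (auto simp: shadow_def X.ray_depth)
  show ?thesis
  proof (cases "common_edges \<zeta> \<xi> \<le> n")
    case True
    have "m \<le> common_edges \<zeta> \<xi>" using X.common_edges_ge[OF assms(1) x'(1)] x x' by simp
    then have "L\<^sub>2 * (real n - real (common_edges \<zeta> \<xi>)) \<le> L\<^sub>2 * (real n - real m)"
      using L_pos by (intro mult_left_mono) auto
    moreover have "F_depth (\<zeta> n) \<le> common_edges (f \<zeta>) (f \<omega>)"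
      using w assms X.ray_depth by (intro F_depth_le[OF shadow_ray]) (auto simp: shadow_def)
    moreover have "real (common_edges (f \<zeta>) (f \<omega>)) - real (F_depth (\<zeta> m))
        \<le> L\<^sub>2 * (real n - real (common_edges \<zeta> \<xi>)) + C"
      using branching_upper[of \<zeta> \<xi> \<omega>] assms x x' w True by simp
    ultimately show ?thesis by linarith
  next
    case False
    then have "\<zeta> n = \<xi> n" using X.rays_agree_common_edges[OF assms(1) x'(1)] x(2) by simp
    then have "\<xi> \<in> shadow X (\<zeta> n)" using x' assms X.ray_depth by (simp add: shadow_def)
    then have "F_depth (\<zeta> n) \<le> F_depth (\<zeta> m)"
      using F_depth_le[OF shadow_ray[OF assms(1)], of \<xi> n] x by simp
    moreover have "0 \<le> L\<^sub>2 * (real n - real m)" using L_pos assms(2) by simp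
    ultimately show ?thesis using C_nonneg by linarith
  qed
qed

lemma gdist_F:
  assumes "x \<in> verts X" "y \<in> verts X"
  shows "L\<^sub>1 * real (gdist X x y) - 2 * C \<le> real (gdist Y (F x) (F y))"
    and "real (gdist Y (F x) (F y)) \<le> L\<^sub>2 * real (gdist X x y) + 2 * C"
proof -
  obtain k \<zeta> \<xi> where k: "k \<le> depth X x" "k \<le> depth X y"
      "gdist X x y = (depth X x - k) + (depth X y - k)"
    and z: "\<zeta> \<in> shadow X x" "\<xi> \<in> shadow X y" "\<zeta> \<noteq> \<xi>" "common_edges \<zeta> \<xi> = k" "common_edges \<xi> \<zeta> = k"
    using X.meet_exists[OF assms] by metis
  have b: "\<zeta> \<in> boundary X" "\<xi> \<in> boundary X" "\<zeta> (depth X x) = x" "\<xi> (depth X y) = y"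
    using z by (auto simp: shadow_def)
  have gX: "real (gdist X x y) = (real (depth X x) - real k) + (real (depth X y) - real k)"
    using k by simp
  show "L\<^sub>1 * real (gdist X x y) - 2 * C \<le> real (gdist Y (F x) (F y))"
  proof -
    obtain j where j: "j \<le> F_depth x" "j \<le> F_depth y"
        "gdist Y (F x) (F y) = (F_depth x - j) + (F_depth y - j)"
      and agree: "\<And>a b. a \<in> shadow Y (F x) \<Longrightarrow> b \<in> shadow Y (F y) \<Longrightarrow> a j = b j"
      using Y.meet_exists[OF F_in_verts[OF assms(1)] F_in_verts[OF assms(2)]] depth_F assms
      by metis
    have "f \<zeta> j = f \<xi> j" using agree f_shadow assms z by blast
    then have "L\<^sub>1 * (real (depth X x) - real k) - C \<le> real (F_depth x) - real j"
      and "L\<^sub>1 * (real (depth X y) - real k) - C \<le> real (F_depth y) - real j"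
      using F_depth_lower[of \<zeta> x \<xi> j] F_depth_lower[of \<xi> y \<zeta> j] z b k by auto
    moreover have "real (gdist Y (F x) (F y)) = (real (F_depth x) - real j) + (real (F_depth y) - real j)"
      using j by simp
    ultimately show ?thesis unfolding gX distrib_left by linarith
  qed
  show "real (gdist Y (F x) (F y)) \<le> L\<^sub>2 * real (gdist X x y) + 2 * C"
  proof -
    have eq: "\<zeta> k = \<xi> k" using X.rays_agree_common_edges[OF b(1,2)] z by simp
    define l where "l = F_depth (\<zeta> k)"
    have l: "l \<le> F_depth x" "l \<le> F_depth y"
      using F_depth_mono[OF b(1,1) refl k(1)] F_depth_mono[OF b(1,2) eq k(2)] b by (auto simp: l_def)
    have "f \<zeta> l = f \<xi> l"
      using F_on_ray_vertex[OF b(1), of k] F_on_ray_vertex[OF b(2), of k] eq by (simp add: l_def)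
    then have "gdist Y (F x) (F y) \<le> (F_depth x - l) + (F_depth y - l)"
      using Y.gdist_via_rays[OF f_ray[OF b(1)] f_ray[OF b(2)] _ l] F_on_ray z by simp
    then have "real (gdist Y (F x) (F y)) \<le> (real (F_depth x) - real l) + (real (F_depth y) - real l)"
      using l by linarith
    moreover have "real (F_depth x) - real l \<le> L\<^sub>2 * (real (depth X x) - real k) + C"
      using F_depth_upper[OF b(1) k(1)] b by (simp add: l_def)
    moreover have "real (F_depth y) - real l \<le> L\<^sub>2 * (real (depth X y) - real k) + C"
      using F_depth_upper[OF b(2) k(2)] b eq by (simp add: l_def)
    ultimately show ?thesis unfolding gX distrib_left by linarith
  qed
qed

lemma F_depth_along_ray:
  assumes "\<zeta> \<in> boundary X"
  shows "L\<^sub>1 * real n - C \<le> real (F_depth (\<zeta> n))"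
proof -
  obtain \<xi> where x: "\<xi> \<in> boundary X" "\<xi> \<noteq> \<zeta>" "common_edges \<zeta> \<xi> = 0"
    using X.ray_branches_off[OF assms] by metis
  have "f \<zeta> 0 = f \<xi> 0" using Y.ray_root[OF f_ray] assms x(1) by simp
  then show ?thesis
    using F_depth_lower[OF shadow_ray[OF assms] x(1), of n 0] x X.ray_depth[OF assms] by simp
qed

lemma F_depth_at_top:
  assumes "\<zeta> \<in> boundary X"
  shows "filterlim (\<lambda>n. real (F_depth (\<zeta> n))) at_top sequentially"
proof (rule filterlim_at_top_mono)
  show "filterlim (\<lambda>n. - C + L\<^sub>1 * real n) at_top sequentially"
    using L_pos by (intro filterlim_tendsto_add_at_top[OF tendsto_const]
        filterlim_tendsto_pos_mult_at_top[OF tendsto_const _ filterlim_real_sequentially])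
  show "\<forall>\<^sub>F n in sequentially. - C + L\<^sub>1 * real n \<le> real (F_depth (\<zeta> n))"
    using F_depth_along_ray[OF assms] by (simp add: algebra_simps)
qed

text \<open>Surjectivity of \<open>f\<close> enters here: the image of the shadow of the root is all of \<open>boundary Y\<close>,
  and that branches at the root.\<close>

lemma F_depth_root: "F_depth (root X) = 0"
proof -
  obtain a where a: "a \<in> boundary Y" using Y.boundary_nonempty by blast
  obtain b where b: "b \<in> boundary Y" "b \<noteq> a" "common_edges a b = 0"
    using Y.ray_branches_off[OF a] by metis
  have "shadow X (root X) = boundary X"
    using X.ray_root by (auto simp: shadow_def X.depth_root)
  then show ?thesis
    using Y.branch_depth_le[of "boundary Y" a b] a b by (simp add: F_depth_def image_boundary)
qed

text \<open>Choose a ray through \<open>y\<close>, and in \<open>X\<close> the ray \<open>\<zeta>\<close> that \<open>f\<close> sends to it. The vertices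
  \<open>F (\<zeta> n)\<close> walk down the chosen ray from the root to infinity and have to step past \<open>y\<close>.\<close>

lemma F_coarsely_onto:
  assumes "y \<in> verts Y"
  obtains x where "x \<in> verts X" "real (gdist Y (F x) y) \<le> L\<^sub>2 + C"
proof -
  obtain \<omega> where "\<omega> \<in> shadow Y y" using Y.shadow_nonempty[OF assms] .
  then obtain \<zeta> where z: "\<zeta> \<in> boundary X" "f \<zeta> (depth Y y) = y"
    using image_boundary by (auto simp: shadow_def) (metis imageE)
  obtain n where "real (depth Y y) < real (F_depth (\<zeta> n))"
    using F_depth_at_top[OF z(1)] unfolding filterlim_at_top_dense eventually_sequentially by blast
  then have "depth Y y < F_depth (\<zeta> n)" by simp
  moreover have "\<not> depth Y y < F_depth (\<zeta> 0)" using F_depth_root X.ray_root[OF z(1)] by simp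
  ultimately obtain m where m: "F_depth (\<zeta> m) \<le> depth Y y" "depth Y y < F_depth (\<zeta> (Suc m))"
    using ex_least_nat_less[of "\<lambda>n. depth Y y < F_depth (\<zeta> n)" n] by (metis le_refl not_less)
  have "gdist Y (F (\<zeta> m)) y = depth Y y - F_depth (\<zeta> m)"
    using Y.ray_gdist[OF f_ray[OF z(1)] m(1)] F_on_ray_vertex[OF z(1)] z(2) by simp
  moreover have "real (F_depth (\<zeta> (Suc m))) - real (F_depth (\<zeta> m)) \<le> L\<^sub>2 + C"
    using F_depth_upper[OF z(1), of m "Suc m"] by simp
  ultimately have "real (gdist Y (F (\<zeta> m)) y) \<le> L\<^sub>2 + C" using m by linarith
  then show thesis using that X.ray_in_verts[OF z(1)] by blast
qed

lemma F_extends: "extends_along_geodesics X Y \<epsilon>Y F f"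
  unfolding extends_along_geodesics_def
proof
  fix \<zeta> assume z: "\<zeta> \<in> boundary X"
  have "(\<lambda>i. exp (- \<epsilon>Y * real (F_depth (\<zeta> i))) / \<epsilon>Y) \<longlonglongrightarrow> 0 / \<epsilon>Y"
    using positive by (intro tendsto_intros exp_at_bot[THEN filterlim_compose]
        filterlim_tendsto_neg_mult_at_bot[OF tendsto_const _ F_depth_at_top[OF z]]) auto
  then show "(\<lambda>i. completion_dist Y \<epsilon>Y (Inl (F (\<zeta> i))) (Inr (f \<zeta>))) \<longlonglongrightarrow> 0"
    using Y.completion_dist_ray[OF f_ray[OF z] positive(2)] F_on_ray_vertex[OF z] by simp
qed

lemma F_rough_quasiisometry: "rough_quasiisometry X Y (max (1 / L\<^sub>1) L\<^sub>2) (2 * C) F"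
  unfolding rough_quasiisometry_def
proof (intro conjI ballI)
  show "F ` verts X \<subseteq> verts Y" using F_in_verts by blast
  fix x y assume V: "x \<in> verts X" "y \<in> verts X"
  have "1 / max (1 / L\<^sub>1) L\<^sub>2 \<le> L\<^sub>1"
    using L_pos by (simp add: divide_simps max_def mult.commute)
  then have "1 / max (1 / L\<^sub>1) L\<^sub>2 * real (gdist X x y) \<le> L\<^sub>1 * real (gdist X x y)"
    by (rule mult_right_mono) simp
  then show "1 / max (1 / L\<^sub>1) L\<^sub>2 * real (gdist X x y) - 2 * C \<le> real (gdist Y (F x) (F y))"
    using gdist_F(1)[OF V] by linarith
  have "L\<^sub>2 * real (gdist X x y) \<le> max (1 / L\<^sub>1) L\<^sub>2 * real (gdist X x y)"
    by (rule mult_right_mono) simp_all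
  then show "real (gdist Y (F x) (F y)) \<le> max (1 / L\<^sub>1) L\<^sub>2 * real (gdist X x y) + 2 * C"
    using gdist_F(2)[OF V] by linarith
next
  fix y assume "y \<in> verts Y"
  then obtain x where "x \<in> verts X" "real (gdist Y (F x) y) \<le> L\<^sub>2 + C" by (rule F_coarsely_onto)
  then show "\<exists>x\<in>verts X. real (gdist Y (F x) y) \<le> max (1 / L\<^sub>1) L\<^sub>2 + 2 * C"
    using C_nonneg by (intro bexI[of _ x]) auto
qed

end

theorem theorem8p2:
  fixes X :: "'a rooted_graph" and Y :: "'b rooted_graph"
    and \<epsilon>X \<epsilon>Y \<alpha>\<^sub>1 \<alpha>\<^sub>2 A L\<^sub>1 L\<^sub>2 L \<Lambda> :: real
    and \<eta> :: "real \<Rightarrow> real"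
    and f :: "(nat \<Rightarrow> 'a) \<Rightarrow> (nat \<Rightarrow> 'b)"
  assumes "rooted_tree X" and "\<forall>x\<in>verts X. 2 \<le> card (children X x)"
    and "rooted_tree Y" and "\<forall>y\<in>verts Y. 2 \<le> card (children Y y)"
    and "\<epsilon>X > 0" and "\<epsilon>Y > 0"
    and "\<alpha>\<^sub>1 > 0" and "\<alpha>\<^sub>2 > 0" and "A > 0"
    and "\<forall>t\<ge>0. \<eta> t = (if t \<le> 1 then A * t powr \<alpha>\<^sub>1 else A * t powr \<alpha>\<^sub>2)"
    and "quasisymmetric (boundary X) (visual_dist \<epsilon>X) (boundary Y) (visual_dist \<epsilon>Y) \<eta> f"
    and "L\<^sub>1 = \<alpha>\<^sub>1 * \<epsilon>X / \<epsilon>Y"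
    and "L\<^sub>2 = \<alpha>\<^sub>2 * \<epsilon>X / \<epsilon>Y"
    and "L = max (1 / L\<^sub>1) L\<^sub>2"
    and "\<Lambda> = 2 * ln A / \<epsilon>Y"
  shows "\<exists>F. rough_quasiisometry X Y L \<Lambda> F \<and>
             extends_along_geodesics X Y \<epsilon>Y F f \<and>
             (\<forall>x1\<in>verts X. \<forall>x2\<in>verts X.
                L\<^sub>1 * real (gdist X x1 x2) - \<Lambda> \<le> real (gdist Y (F x1) (F x2)) \<and>
                real (gdist Y (F x1) (F x2)) \<le> L\<^sub>2 * real (gdist X x1 x2) + \<Lambda>)"
proof -
  interpret power_quasisymmetry X Y \<epsilon>X \<epsilon>Y \<alpha>\<^sub>1 \<alpha>\<^sub>2 A \<eta> f
  proof unfold_locales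
    show "2 \<le> card (children X x)" if "x \<in> verts X" for x using assms(2) that by blast
    show "2 \<le> card (children Y y)" if "y \<in> verts Y" for y using assms(4) that by blast
    show "\<eta> t = (if t \<le> 1 then A * t powr \<alpha>\<^sub>1 else A * t powr \<alpha>\<^sub>2)" if "t \<ge> 0" for t
      using assms(10) that by blast
  qed (fact assms)+
  have eqs: "L\<^sub>1 = power_quasisymmetry.L\<^sub>1 \<epsilon>X \<epsilon>Y \<alpha>\<^sub>1" "L\<^sub>2 = power_quasisymmetry.L\<^sub>2 \<epsilon>X \<epsilon>Y \<alpha>\<^sub>2"
      "\<Lambda> = 2 * C"
    using assms unfolding L\<^sub>1_def L\<^sub>2_def C_def by auto
  show ?thesis
    using F_rough_quasiisometry F_extends gdist_F assms(14) unfolding eqs by blast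
qed

end
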